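(* Let $f,g,h$ be functions on $\mathbb{R}^n$, with $F=f+g+h$, satisfying the assumptions in the context. Let $a>0$ and let $(x_k)_{k\ge1}$ be generated by the PRISMA algorithm (defined in the context) with $\beta_k=\frac{1}{ak}$ for all $k\ge1$. Then, for every integer $k\ge 1$ and every $x^*\in\operatorname{dom}h$, $$F(x_{k+1})-F(x^* )\le 2\,\frac{L_f+ak}{(k+1)^2}\left[\|x^*-x_1\|^2+\frac{\rho_g^2}{a}\left(\frac{3}{2a}\log\frac{L_f+ak}{L_f+a}+\frac{1}{L_f+a}\right)\right].$$
   Context: Norms and inner products are Euclidean; $\log$ is the natural logarithm. Assumptions: (i) $f:\mathbb{R}^n\to\mathbb{R}$ is convex and $L_f$-smooth, i.e. differentiable with $\|\nabla f(x)-\nabla f(y)\|\le L_f\|x-y\|$ for all $x,y\in\mathbb{R}^n$; (ii) $g:\mathbb{R}^n\to\mathbb{R}$ is convex and $\rho_g$-Lipschitz, i.e. $|g(x)-g(y)|\le\rho_g\|x-y\|$ for all $x,y$; (iii) $h:\mathbb{R}^n\to\mathbb{R}\cup\{+\infty\}$ is proper, lower semicontinuous and convex, with $\operatorname{dom}h=\{x:h(x)<+\infty\}$. Put $F(x)=f(x)+g(x)+h(x)$. Proximity operator: for a proper lower semicontinuous convex function $\varphi$, $x\in\mathbb{R}^n$ and $\alpha>0$, $\operatorname{prox}_\varphi(x,\alpha)=\operatorname{argmin}_{u\in\mathbb{R}^n}\left\{\frac{\|x-u\|^2}{2\alpha}+\varphi(u)\right\}$. PRISMA algorithm with parameters $\beta_k>0$,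 $k\in\{1,2,\dots\}$: choose $x_1=y_1\in\operatorname{dom}h$, set $\theta_1=1$, $L_1=L_f+\frac1{\beta_1}$, and for $k=1,2,\dots$ set $$L_{k+1}=L_f+\frac1{\beta_{k+1}},\qquad \theta_{k+1}=\frac{2}{1+\sqrt{1+\frac{4L_{k+1}}{\theta_k^2L_k}}},$$ $$x_{k+1}=\operatorname{prox}_h\left(\Big(1-\tfrac1{L_k\beta_k}\Big)y_k-\tfrac1{L_k}\nabla f(y_k)+\tfrac1{L_k\beta_k}\operatorname{prox}_g(y_k,\beta_k),\ \tfrac1{L_k}\right),$$ $$y_{k+1}=x_{k+1}+\theta_{k+1}\left(\tfrac1{\theta_k}-1\right)(x_{k+1}-x_k).$$ *)

theory Defs
  imports "HOL-Analysis.Analysis"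
begin

text \<open>The description picks out the gradient only where it exists, i.e. where \<open>f\<close> is
  differentiable; elsewhere the value is unspecified.\<close>

definition gradient :: "('a::euclidean_space \<Rightarrow> real) \<Rightarrow> 'a \<Rightarrow> 'a" where
  "gradient f x = (THE D. GDERIV f x :> D)"

definition smooth :: "real \<Rightarrow> ('a::euclidean_space \<Rightarrow> real) \<Rightarrow> bool" where
  "smooth L f \<longleftrightarrow> (\<forall>x. f differentiable (at x)) \<and>
     (\<forall>x y. norm (gradient f x - gradient f y) \<le> L * norm (x - y))"

definition edom :: "('a \<Rightarrow> ereal) \<Rightarrow> 'a set" where
  "edom h = {x. h x < \<infinity>}"

definition proper_fun :: "('a \<Rightarrow> ereal) \<Rightarrow> bool" where
  "proper_fun h \<longleftrightarrow> (\<forall>x. h x \<noteq> -\<infinity>) \<and> edom h \<noteq> {}"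

definition lsc :: "('a::topological_space \<Rightarrow> ereal) \<Rightarrow> bool" where
  "lsc h \<longleftrightarrow> (\<forall>x. h x \<le> Liminf (at x) h)"

text \<open>In \<^typ>\<open>ereal\<close>, \<open>0 * \<infinity> = 0\<close>, so the cases \<open>u = 0\<close> and \<open>v = 0\<close> below
  are trivially true. The notion is meant for functions that do not attain \<open>-\<infinity>\<close>.\<close>

definition econvex :: "('a::real_vector \<Rightarrow> ereal) \<Rightarrow> bool" where
  "econvex h \<longleftrightarrow> (\<forall>x y u v. 0 \<le> u \<and> 0 \<le> v \<and> u + v = 1 \<longrightarrow>
     h (u *\<^sub>R x + v *\<^sub>R y) \<le> ereal u * h x + ereal v * h y)"

text \<open>For proper lower semicontinuous convex \<open>\<phi>\<close> and \<open>\<alpha> > 0\<close> the objective has exactly one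
  minimizer, so the choice made by \<^const>\<open>arg_min\<close> is immaterial.\<close>

definition prox :: "('a::euclidean_space \<Rightarrow> ereal) \<Rightarrow> 'a \<Rightarrow> real \<Rightarrow> 'a" where
  "prox \<phi> x \<alpha> = (ARG_MIN (\<lambda>u. ereal ((norm (x - u))\<^sup>2 / (2 * \<alpha>)) + \<phi> u) u. True)"

text \<open>Sequences are indexed from 1; their values at 0 are irrelevant.\<close>

definition prisma ::
  "real \<Rightarrow> ('a::euclidean_space \<Rightarrow> real) \<Rightarrow> ('a \<Rightarrow> real) \<Rightarrow> ('a \<Rightarrow> ereal) \<Rightarrow> (nat \<Rightarrow> real) \<Rightarrow>
   (nat \<Rightarrow> real) \<Rightarrow> (nat \<Rightarrow> real) \<Rightarrow> (nat \<Rightarrow> 'a) \<Rightarrow> (nat \<Rightarrow> 'a) \<Rightarrow> bool" where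
  "prisma L\<^sub>f f g h \<beta> L \<theta> x y \<longleftrightarrow>
     (\<forall>k\<ge>1. \<beta> k > 0) \<and>
     x 1 \<in> edom h \<and> y 1 = x 1 \<and> \<theta> 1 = 1 \<and> L 1 = L\<^sub>f + 1 / \<beta> 1 \<and>
     (\<forall>k\<ge>1.
        L (k + 1) = L\<^sub>f + 1 / \<beta> (k + 1) \<and>
        \<theta> (k + 1) = 2 / (1 + sqrt (1 + 4 * L (k + 1) / ((\<theta> k)\<^sup>2 * L k))) \<and>
        x (k + 1) =
          prox h
            ((1 - 1 / (L k * \<beta> k)) *\<^sub>R y k - (1 / L k) *\<^sub>R gradient f (y k)
              + (1 / (L k * \<beta> k)) *\<^sub>R prox (\<lambda>u. ereal (g u)) (y k) (\<beta> k))
            (1 / L k) \<and>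
        y (k + 1) = x (k + 1) + (\<theta> (k + 1) * (1 / \<theta> k - 1)) *\<^sub>R (x (k + 1) - x k))"

end

(* With the Moreau envelope g_b of g in place of g, the update is an accelerated proximal gradient
   step for the objective f + g_b + h, whose smooth part has the Lipschitz gradient constant
   L_f + 1/b. Since g_b <= g <= g_b + b rho^2 / 2, and since g_b increases while
   g_b + b rho^2 / 2 decreases as b shrinks, the gap f + g_b + b rho^2 / 2 + h - (f + g_b + h)(u)
   can be compared between consecutive steps, so that the usual potential argument telescopes up to
   the error rho^2 / 2 * sum_j b_j / (L_j theta_j). For b_j = 1 / (a j) this sum is logarithmic,
   because (j + 1) / 2 <= 1 / theta_j <= 3 j / 2. *)

theory Submission
  imports Defs
begin

section \<open>Lower semicontinuity and attainment of infima\<close>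

lemma lsc_iff_eventually:
  fixes \<phi> :: "'a::perfect_space \<Rightarrow> ereal"
  shows "lsc \<phi> \<longleftrightarrow> (\<forall>x c. c < \<phi> x \<longrightarrow> (\<forall>\<^sub>F u in nhds x. c < \<phi> u))"
  unfolding lsc_def le_Liminf_iff eventually_nhds_conv_at by blast

lemma lsc_continuous:
  fixes q :: "'a::perfect_space \<Rightarrow> real"
  assumes "continuous_on UNIV q"
  shows "lsc (\<lambda>u. ereal (q u))"
proof -
  have "((\<lambda>u. ereal (q u)) \<longlongrightarrow> ereal (q x)) (at x)" for x
    using assms by (auto simp: continuous_on_def)
  then show ?thesis
    unfolding lsc_def by (intro allI eq_refl lim_imp_Liminf[symmetric]) auto
qed

lemma lsc_continuous_add:
  fixes \<phi> :: "'a::perfect_space \<Rightarrow> ereal"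
  assumes q: "continuous_on UNIV q" and \<phi>: "lsc \<phi>"
  shows "lsc (\<lambda>u. ereal (q u) + \<phi> u)"
  unfolding lsc_iff_eventually
proof (intro allI impI)
  fix x c assume c: "c < ereal (q x) + \<phi> x"
  have lim: "((\<lambda>u. c - ereal (q u)) \<longlongrightarrow> c - ereal (q x)) (nhds x)"
  proof (cases c)
    case (real b)
    have "(q \<longlongrightarrow> q x) (nhds x)"
      using q by (simp add: continuous_on_def tendsto_at_iff_tendsto_nhds)
    then have "((\<lambda>u. b - q u) \<longlongrightarrow> b - q x) (nhds x)"
      by (intro tendsto_diff tendsto_const)
    then show ?thesis by (simp add: real)
  qed simp_all
  have shift: "c < ereal r + z \<longleftrightarrow> c - ereal r < z" for r z
    by (cases c; cases z) auto
  \<comment> \<open>The level \<open>e\<close> decouples the two summands: near \<open>x\<close>,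
    continuity keeps \<open>c - q\<close> below \<open>e\<close>, and lower semicontinuity keeps
    \<open>\<phi>\<close> above it. Extended values of \<open>c\<close> and \<open>\<phi>\<close>
    are thus covered without a separate argument.\<close>
  obtain e where e: "c - ereal (q x) < e" "e < \<phi> x"
    using c dense shift by blast
  show "\<forall>\<^sub>F u in nhds x. c < ereal (q u) + \<phi> u"
    using order_tendstoD(2)[OF lim e(1)] \<phi>[unfolded lsc_iff_eventually, rule_format, OF e(2)]
    by eventually_elim (simp add: shift)
qed

text \<open>The sublevel sets at the heights \<open>\<phi> v\<close> with \<open>v\<close> in
  \<open>K\<close> are closed, and any finitely many of them share the point with the smallest
  value. By compactness all of them share a point of \<open>K\<close>, which is a minimizer.\<close>

lemma lsc_attains_inf:
  fixes \<phi> :: "'a::perfect_space \<Rightarrow> ereal"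
  assumes \<phi>: "lsc \<phi>" and K: "compact K" "K \<noteq> {}"
  obtains p where "p \<in> K" "\<And>u. u \<in> K \<Longrightarrow> \<phi> p \<le> \<phi> u"
proof -
  have "K \<inter> \<Inter>((\<lambda>v. {u. \<phi> u \<le> \<phi> v}) ` K) \<noteq> {}"
  proof (rule compact_imp_fip_image[OF K(1)])
    fix v
    have "open {u. \<phi> v < \<phi> u}"
      using \<phi> by (subst open_subopen) (auto simp: lsc_iff_eventually eventually_nhds subset_eq)
    then show "closed {u. \<phi> u \<le> \<phi> v}"
      by (simp add: closed_def Collect_neg_eq[symmetric] not_le)
  next
    fix I assume I: "finite I" "I \<subseteq> K"
    show "K \<inter> \<Inter>((\<lambda>v. {u. \<phi> u \<le> \<phi> v}) ` I) \<noteq> {}"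
    proof (cases "I = {}")
      case False
      then have "Min (\<phi> ` I) \<in> \<phi> ` I" using I by simp
      then obtain p where "p \<in> I" "\<phi> p = Min (\<phi> ` I)" by force
      then show ?thesis using I by (auto intro!: exI[of _ p])
    qed (use K in auto)
  qed
  then show ?thesis using that by blast
qed

section \<open>Existence and variational characterization of proximal points\<close>

lemma proper_fun_finite:
  assumes "proper_fun \<phi>" "u \<in> edom \<phi>"
  shows "\<phi> u = ereal (real_of_ereal (\<phi> u))"
  using assms by (cases "\<phi> u") (auto simp: proper_fun_def edom_def)

lemma econvex_segment:
  assumes \<phi>: "proper_fun \<phi>" "econvex \<phi>" and u: "u \<in> edom \<phi>" and v: "v \<in> edom \<phi>" and t: "0 \<le> t" "t \<le> 1"
  shows "\<phi> (u + t *\<^sub>R (v - u)) \<le>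
    ereal (real_of_ereal (\<phi> u) + t * (real_of_ereal (\<phi> v) - real_of_ereal (\<phi> u)))"
proof -
  obtain a b where ab: "\<phi> u = ereal a" "\<phi> v = ereal b"
    using proper_fun_finite[OF \<phi>(1)] u v by blast
  have "\<phi> ((1 - t) *\<^sub>R u + t *\<^sub>R v) \<le> ereal (1 - t) * \<phi> u + ereal t * \<phi> v"
    by (rule \<phi>(2)[unfolded econvex_def, rule_format]) (use t in simp)
  moreover have "(1 - t) *\<^sub>R u + t *\<^sub>R v = u + t *\<^sub>R (v - u)"
    by (simp add: algebra_simps)
  moreover have "(1 - t) * a + t * b = a + t * (b - a)"
    by (simp add: algebra_simps)
  ultimately show ?thesis
    by (simp add: ab)
qed

text \<open>\<open>prox\<close> is an \<open>arg_min\<close>, about which nothing is known until a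
  minimizer exists. A minimizer over a large ball around a point \<open>x0\<close> of the domain is
  global, because outside the ball the objective is at least its value at \<open>x0\<close>.\<close>

lemma prox_objective_attains_inf:
  fixes \<phi> :: "'a::euclidean_space \<Rightarrow> ereal"
  assumes \<phi>: "proper_fun \<phi>" "lsc \<phi>" "econvex \<phi>" and \<alpha>: "\<alpha> > 0"
  obtains p where "\<And>u. ereal ((norm (x - p))\<^sup>2 / (2 * \<alpha>)) + \<phi> p \<le> ereal ((norm (x - u))\<^sup>2 / (2 * \<alpha>)) + \<phi> u"
proof -
  define r where "r u = real_of_ereal (\<phi> u)" for u
  define obj where "obj u = ereal ((norm (x - u))\<^sup>2 / (2 * \<alpha>)) + \<phi> u" for u
  have fin: "\<phi> u = ereal (r u)" if "u \<in> edom \<phi>" for u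
    using proper_fun_finite[OF \<phi>(1) that] by (simp add: r_def)
  obtain x0 where x0: "x0 \<in> edom \<phi>"
    using \<phi>(1) by (auto simp: proper_fun_def)
  \<comment> \<open>The minimum over the unit ball bounds how far \<open>\<phi>\<close> can fall
    within distance 1 of \<open>x0\<close>; convexity then bounds its fall at any larger
    distance.\<close>
  obtain m where m: "m \<in> cball x0 1" "\<And>u. u \<in> cball x0 1 \<Longrightarrow> \<phi> m \<le> \<phi> u"
    using lsc_attains_inf[OF \<phi>(2), of "cball x0 1"] by auto
  have m_dom: "m \<in> edom \<phi>"
    using m(2)[of x0] x0 by (auto simp: edom_def)
  define M where "M = r x0 - r m"
  have M: "M \<ge> 0"
    using m(2)[of x0] fin[OF x0] fin[OF m_dom] by (simp add: M_def)
  define d where "d = norm (x - x0)"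
  \<comment> \<open>For a distance \<open>\<rho>\<close> above \<open>R\<close>, the square of
    \<open>\<rho>\<close> exceeds both the cross term \<open>2 * d * \<rho>\<close> of
    \<open>(\<rho> - d)\<^sup>2\<close> and the possible fall \<open>M * \<rho>\<close> scaled by
    \<open>2 * \<alpha>\<close>. The summand 1 ensures that the ray leaves the unit ball before it
    reaches \<open>u\<close>.\<close>
  define R where "R = 1 + 2 * d + 2 * \<alpha> * M"
  have R: "R \<ge> 1" using M \<alpha> by (simp add: R_def d_def)
  have "lsc obj"
    unfolding obj_def[abs_def] using \<alpha> by (intro lsc_continuous_add \<phi> continuous_intros) auto
  then obtain p where p: "p \<in> cball x0 R" "\<And>u. u \<in> cball x0 R \<Longrightarrow> obj p \<le> obj u"
    using lsc_attains_inf[of obj "cball x0 R"] R by auto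
  have "obj p \<le> obj u" for u
  proof (cases "u \<in> edom \<phi> \<and> u \<notin> cball x0 R")
    case False
    then show ?thesis using p(2) by (auto simp: edom_def obj_def)
  next
    case True
    define \<rho> where "\<rho> = norm (u - x0)"
    have \<rho>: "\<rho> > R" using True by (simp add: \<rho>_def dist_norm norm_minus_commute)
    \<comment> \<open>Convexity along the ray from \<open>x0\<close> through \<open>u\<close> gives a lower bound linear in \<open>\<rho>\<close>,
      which the quadratic term dominates for large \<open>\<rho>\<close>.\<close>
    have "\<phi> m \<le> \<phi> (x0 + (1 / \<rho>) *\<^sub>R (u - x0))"
      using \<rho> R by (intro m(2)) (simp add: dist_norm \<rho>_def[symmetric])
    also have "\<dots> \<le> ereal (r x0 + 1 / \<rho> * (r u - r x0))"
      unfolding r_def using \<rho> R by (intro econvex_segment \<phi> x0 conjunct1[OF True]) auto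
    finally have "r m \<le> r x0 + (r u - r x0) / \<rho>"
      by (simp add: fin m_dom)
    then have lower: "r x0 - M * \<rho> \<le> r u"
      using \<rho> R by (simp add: M_def field_simps)
    have "\<rho> \<le> norm (x - u) + d"
      using norm_triangle_ineq[of "u - x" "x - x0"] by (simp add: \<rho>_def d_def norm_minus_commute)
    moreover have "d \<le> \<rho>"
      using \<rho> mult_nonneg_nonneg[OF less_imp_le[OF \<alpha>] M] norm_ge_zero[of "x - x0"]
      unfolding R_def d_def by linarith
    ultimately have "(\<rho> - d)\<^sup>2 \<le> (norm (x - u))\<^sup>2"
      by (intro power_mono) auto
    moreover have "\<rho> * (2 * d + 2 * \<alpha> * M) \<le> \<rho> * \<rho>"
      using \<rho> R by (intro mult_left_mono) (auto simp: R_def)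
    ultimately have "d\<^sup>2 + 2 * \<alpha> * M * \<rho> \<le> (norm (x - u))\<^sup>2"
      by (simp add: power2_eq_square algebra_simps)
    then have "(d\<^sup>2 + 2 * \<alpha> * M * \<rho>) / (2 * \<alpha>) \<le> (norm (x - u))\<^sup>2 / (2 * \<alpha>)"
      using \<alpha> by (intro divide_right_mono) auto
    then have "d\<^sup>2 / (2 * \<alpha>) + M * \<rho> \<le> (norm (x - u))\<^sup>2 / (2 * \<alpha>)"
      using \<alpha> by (simp add: add_divide_distrib)
    then have "obj x0 \<le> obj u"
      using lower True by (simp add: obj_def fin x0 d_def)
    moreover have "obj p \<le> obj x0"
      using p(2) R by simp
    ultimately show ?thesis by simp
  qed
  then show ?thesis
    unfolding obj_def by (rule that)
qed

lemma norm_diff_scaleR_sq: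
  fixes a b :: "'a::real_inner"
  shows "(norm (a - t *\<^sub>R b))\<^sup>2 = (norm a)\<^sup>2 - 2 * t * inner a b + t\<^sup>2 * (norm b)\<^sup>2"
  using dot_norm_neg[of a "t *\<^sub>R b"] by (simp add: power_mult_distrib)

text \<open>Comparing the minimizer \<open>p\<close> with \<open>p + t (u - p)\<close> and dividing
  by \<open>t\<close> leaves an error \<open>t * c\<close>, which vanishes as \<open>t\<close> tends
  to 0. The outcome is that \<open>(x - p) / \<alpha>\<close> is a subgradient of
  \<open>\<phi>\<close> at \<open>p\<close>.\<close>

lemma prox_subgradient:
  fixes \<phi> :: "'a::euclidean_space \<Rightarrow> ereal"
  assumes \<phi>: "proper_fun \<phi>" "lsc \<phi>" "econvex \<phi>" and \<alpha>: "\<alpha> > 0"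
  shows prox_in_edom: "prox \<phi> x \<alpha> \<in> edom \<phi>"
    and "u \<in> edom \<phi> \<Longrightarrow> real_of_ereal (\<phi> (prox \<phi> x \<alpha>)) + inner (x - prox \<phi> x \<alpha>) (u - prox \<phi> x \<alpha>) / \<alpha>
      \<le> real_of_ereal (\<phi> u)"
proof -
  define r where "r u = real_of_ereal (\<phi> u)" for u
  have fin: "\<phi> u = ereal (r u)" if "u \<in> edom \<phi>" for u
    using proper_fun_finite[OF \<phi>(1) that] by (simp add: r_def)
  define p where "p = prox \<phi> x \<alpha>"
  obtain p' where p': "\<And>u. ereal ((norm (x - p'))\<^sup>2 / (2 * \<alpha>)) + \<phi> p' \<le> ereal ((norm (x - u))\<^sup>2 / (2 * \<alpha>)) + \<phi> u"
    using prox_objective_attains_inf[OF assms, of x] by blast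
  have p: "ereal ((norm (x - p))\<^sup>2 / (2 * \<alpha>)) + \<phi> p \<le> ereal ((norm (x - u))\<^sup>2 / (2 * \<alpha>)) + \<phi> u" for u
    unfolding p_def prox_def by (rule arg_minI[of _ p']) (use p' in \<open>auto simp: not_less\<close>)
  obtain x0 where x0: "x0 \<in> edom \<phi>"
    using \<phi>(1) by (auto simp: proper_fun_def)
  show dom: "p \<in> edom \<phi>"
    using p[of x0] by (auto simp: fin[OF x0] edom_def)
  assume u: "u \<in> edom \<phi>"
  define s where "s = inner (x - p) (u - p) / \<alpha>"
  define c where "c = (norm (u - p))\<^sup>2 / (2 * \<alpha>)"
  have c: "c \<ge> 0" using \<alpha> by (simp add: c_def)
  have t_le: "r p + s - r u \<le> t * c" if t: "0 < t" "t \<le> 1" for t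
  proof -
    let ?v = "p + t *\<^sub>R (u - p)"
    have v: "\<phi> ?v \<le> ereal (r p + t * (r u - r p))"
      unfolding r_def using t by (intro econvex_segment \<phi> dom u) auto
    have sq: "(norm (x - ?v))\<^sup>2 = (norm (x - p))\<^sup>2 - 2 * t * inner (x - p) (u - p) + t\<^sup>2 * (norm (u - p))\<^sup>2"
      using norm_diff_scaleR_sq[of "x - p" t "u - p"] by (simp add: diff_diff_eq)
    have "ereal ((norm (x - p))\<^sup>2 / (2 * \<alpha>)) + ereal (r p)
        \<le> ereal ((norm (x - ?v))\<^sup>2 / (2 * \<alpha>)) + ereal (r p + t * (r u - r p))"
      using order_trans[OF p[of ?v] add_left_mono[OF v]] by (simp add: fin dom)
    then have "(norm (x - p))\<^sup>2 / (2 * \<alpha>) \<le> (norm (x - ?v))\<^sup>2 / (2 * \<alpha>) + t * (r u - r p)"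
      by simp
    also have "(norm (x - ?v))\<^sup>2 / (2 * \<alpha>) = (norm (x - p))\<^sup>2 / (2 * \<alpha>) - t * s + t\<^sup>2 * c"
      using \<alpha> by (simp add: sq s_def c_def add_divide_distrib diff_divide_distrib)
    finally have "t * (r p + s - r u) \<le> t * (t * c)"
      by (simp add: power2_eq_square algebra_simps)
    then show ?thesis using t by simp
  qed
  have "r p + s - r u \<le> 0"
  proof (rule ccontr)
    define b where "b = r p + s - r u"
    assume "\<not> ?thesis"
    then have b: "b > 0" by (simp add: b_def)
    \<comment> \<open>In place of a limit, the single value \<open>t = b / (b + c)\<close> already
      contradicts \<open>b > 0\<close>.\<close>
    have "b \<le> b / (b + c) * c"
      using b c unfolding b_def[symmetric] by (intro t_le[folded b_def]) auto
    then have "b * b \<le> 0"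
      using b c by (simp add: field_simps)
    then show False using b by (simp add: mult_le_0_iff)
  qed
  then show "real_of_ereal (\<phi> p) + inner (x - p) (u - p) / \<alpha> \<le> real_of_ereal (\<phi> u)"
    by (simp add: r_def s_def)
qed

section \<open>First-order inequalities for smooth convex functions\<close>

text \<open>In finite dimension every linear functional is an inner product with the vector
  assembled from its values on \<open>Basis\<close>. Uniqueness of that vector makes the description
  in \<open>gradient\<close> well defined.\<close>

lemma gradient_GDERIV:
  fixes f :: "'a::euclidean_space \<Rightarrow> real"
  assumes "f differentiable (at x)"
  shows "GDERIV f x :> gradient f x"
proof -
  obtain D where D: "(f has_derivative D) (at x)"
    using assms by (auto simp: differentiable_def)
  then have "linear D" by (rule has_derivative_linear)
  then have "D h = inner h (\<Sum>b\<in>Basis. D b *\<^sub>R b)" for h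
    by (subst euclidean_representation[symmetric, of h], subst linear_sum[OF \<open>linear D\<close>])
       (simp add: linear_scale inner_sum_right inner_commute mult.commute)
  then have "D = (\<lambda>h. inner h (\<Sum>b\<in>Basis. D b *\<^sub>R b))" ..
  then have ex: "GDERIV f x :> (\<Sum>b\<in>Basis. D b *\<^sub>R b)"
    using D by (simp add: gderiv_def)
  have "E = E'" if "GDERIV f x :> E" "GDERIV f x :> E'" for E E'
  proof -
    have "(\<lambda>h. inner h E) = (\<lambda>h. inner h E')"
      using that unfolding gderiv_def by (rule has_derivative_unique)
    then show ?thesis
      by (simp add: fun_eq_iff vector_eq_ldot)
  qed
  then show ?thesis
    unfolding gradient_def using ex by (intro theI[of "\<lambda>D. GDERIV f x :> D", OF ex])
qed

lemma smooth_has_derivative_line: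
  fixes f :: "'a::euclidean_space \<Rightarrow> real"
  assumes "smooth L f"
  shows "((\<lambda>t. f (u + t *\<^sub>R w)) has_real_derivative inner (gradient f (u + t *\<^sub>R w)) w) (at t)"
proof -
  have "((\<lambda>s. u + s *\<^sub>R w) has_derivative (\<lambda>s. s *\<^sub>R w)) (at t)"
    by (auto intro!: derivative_eq_intros)
  moreover have "(f has_derivative (\<lambda>h. inner h (gradient f (u + t *\<^sub>R w)))) (at (u + t *\<^sub>R w))"
    using assms gradient_GDERIV by (auto simp: smooth_def gderiv_def)
  ultimately show ?thesis
    unfolding has_field_derivative_def
    by (rule has_derivative_subst[OF has_derivative_compose]) (simp add: inner_commute mult.commute fun_eq_iff)
qed

lemma smooth_convex_gradient:
  fixes f :: "'a::euclidean_space \<Rightarrow> real"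
  assumes "smooth L f" "convex_on UNIV f"
  shows "f u + inner (gradient f u) (v - u) \<le> f v"
proof -
  have "convex_on UNIV (\<lambda>t. f (u + t *\<^sub>R (v - u)))"
  proof (rule convex_onI)
    fix t x y :: real assume "0 < t" "t < 1"
    then have "f ((1 - t) *\<^sub>R (u + x *\<^sub>R (v - u)) + t *\<^sub>R (u + y *\<^sub>R (v - u)))
      \<le> (1 - t) * f (u + x *\<^sub>R (v - u)) + t * f (u + y *\<^sub>R (v - u))"
      by (intro convex_onD[OF assms(2)]) auto
    then show "f (u + ((1 - t) *\<^sub>R x + t *\<^sub>R y) *\<^sub>R (v - u))
      \<le> (1 - t) * f (u + x *\<^sub>R (v - u)) + t * f (u + y *\<^sub>R (v - u))"
      by (simp add: algebra_simps)
  qed auto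
  from convex_on_imp_above_tangent[OF this _ _ _ smooth_has_derivative_line[OF assms(1), of u "v - u" 0], of 1]
  show ?thesis by simp
qed

lemma smooth_quadratic_bound:
  fixes f :: "'a::euclidean_space \<Rightarrow> real"
  assumes "smooth L f"
  shows "f v \<le> f u + inner (gradient f u) (v - u) + L / 2 * (norm (v - u))\<^sup>2"
proof -
  define w where "w = v - u"
  \<comment> \<open>The claim is \<open>\<psi> 1 \<le> \<psi> 0\<close>. Cauchy-Schwarz and the
    Lipschitz gradient make the derivative of \<open>\<psi>\<close> nonpositive on the unit
    interval, which replaces integrating the gradient along the segment.\<close>
  define \<psi> where "\<psi> t = f (u + t *\<^sub>R w) - t * inner (gradient f u) w - t\<^sup>2 * (L / 2 * (norm w)\<^sup>2)" for t
  have "\<psi> 1 \<le> \<psi> 0"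
  proof (rule DERIV_nonpos_imp_nonincreasing[of 0 1 \<psi>])
    fix t :: real assume t: "0 \<le> t" "t \<le> 1"
    define D where "D = inner (gradient f (u + t *\<^sub>R w)) w - inner (gradient f u) w - t * (L * (norm w)\<^sup>2)"
    have "(\<psi> has_real_derivative D) (at t)"
      unfolding \<psi>_def D_def
      by (auto intro!: derivative_eq_intros smooth_has_derivative_line[OF assms])
    moreover have "inner (gradient f (u + t *\<^sub>R w) - gradient f u) w \<le> norm (gradient f (u + t *\<^sub>R w) - gradient f u) * norm w"
      by (rule norm_cauchy_schwarz)
    moreover have "\<dots> \<le> (L * norm (u + t *\<^sub>R w - u)) * norm w"
      using assms unfolding smooth_def by (intro mult_right_mono norm_ge_zero) blast
    ultimately show "\<exists>y. (\<psi> has_real_derivative y) (at t) \<and> y \<le> 0"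
      using t by (intro exI[of _ D]) (simp add: D_def inner_diff_left power2_eq_square algebra_simps)
  qed simp
  then show ?thesis by (simp add: \<psi>_def w_def)
qed

text \<open>A Euclidean space contains a unit vector, and the Lipschitz inequality between it and 0
  bounds \<open>L\<close> from below by a norm.\<close>

lemma smooth_nonneg:
  fixes f :: "'a::euclidean_space \<Rightarrow> real"
  assumes "smooth L f"
  shows "L \<ge> 0"
proof -
  obtain b :: 'a where "b \<in> Basis" using nonempty_Basis by blast
  then have "norm (b - 0) = 1"
    by simp
  then have "norm (gradient f b - gradient f 0) \<le> L"
    using assms unfolding smooth_def by (metis mult.right_neutral)
  then show ?thesis using norm_ge_zero order_trans by blast
qed

section \<open>The Moreau envelope\<close>

lemma prox_real_subgradient:
  fixes g :: "'a::euclidean_space \<Rightarrow> real"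
  assumes g: "convex_on UNIV g" and \<beta>: "\<beta> > 0"
  defines "q \<equiv> \<lambda>u. prox (\<lambda>u. ereal (g u)) u \<beta>"
  shows "g (q u) + inner (u - q u) (v - q u) / \<beta> \<le> g v"
proof -
  have "proper_fun (\<lambda>u. ereal (g u))" "v \<in> edom (\<lambda>u. ereal (g u))"
    by (auto simp: proper_fun_def edom_def)
  moreover have "lsc (\<lambda>u. ereal (g u))"
    using g by (intro lsc_continuous convex_on_continuous) auto
  moreover have "econvex (\<lambda>u. ereal (g u))"
    using g by (auto simp: econvex_def convex_on_def)
  ultimately show ?thesis
    using prox_subgradient(2)[of "\<lambda>u. ereal (g u)" \<beta> v u] \<beta> by (simp add: q_def)
qed

text \<open>The usual infimum over \<open>v\<close> of
  \<open>g v + (norm (u - v))\<^sup>2 / (2 * \<beta>)\<close> is written here as the value at the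
  proximal point; \<open>moreau_envelope_le\<close> confirms that this value is a lower
  bound.\<close>

definition moreau_envelope :: "('a::euclidean_space \<Rightarrow> real) \<Rightarrow> real \<Rightarrow> 'a \<Rightarrow> real" where
  "moreau_envelope g \<beta> u =
     g (prox (\<lambda>u. ereal (g u)) u \<beta>) + (norm (u - prox (\<lambda>u. ereal (g u)) u \<beta>))\<^sup>2 / (2 * \<beta>)"

lemma moreau_envelope_le:
  fixes g :: "'a::euclidean_space \<Rightarrow> real"
  assumes "convex_on UNIV g" "\<beta> > 0"
  shows "moreau_envelope g \<beta> u \<le> g v + (norm (u - v))\<^sup>2 / (2 * \<beta>)"
proof -
  define q where "q = prox (\<lambda>u. ereal (g u)) u \<beta>"
  have "(norm (u - v))\<^sup>2 = (norm (u - q))\<^sup>2 - 2 * inner (u - q) (v - q) + (norm (v - q))\<^sup>2"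
    by (simp add: power2_norm_eq_inner inner_diff_left inner_diff_right inner_commute)
  then have "(norm (u - q))\<^sup>2 / (2 * \<beta>) \<le> inner (u - q) (v - q) / \<beta> + (norm (u - v))\<^sup>2 / (2 * \<beta>)"
    using assms(2) by (simp add: field_simps)
  moreover have "g q + inner (u - q) (v - q) / \<beta> \<le> g v"
    using prox_real_subgradient[OF assms] by (simp add: q_def)
  ultimately show ?thesis
    by (simp add: moreau_envelope_def q_def)
qed

text \<open>The proximal point of \<open>u\<close> serves as competitor in the envelope at
  \<open>v\<close>, and expanding the square gives the bound. Together with
  \<open>moreau_envelope_gradient\<close> this captures smoothness with constant
  \<open>1 / \<beta>\<close> and slope \<open>(u - q u) / \<beta>\<close> without differentiating
  the envelope.\<close>

lemma moreau_envelope_quadratic_bound: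
  fixes g :: "'a::euclidean_space \<Rightarrow> real"
  assumes "convex_on UNIV g" "\<beta> > 0"
  defines "q \<equiv> \<lambda>u. prox (\<lambda>u. ereal (g u)) u \<beta>"
  shows "moreau_envelope g \<beta> v \<le>
    moreau_envelope g \<beta> u + inner ((1 / \<beta>) *\<^sub>R (u - q u)) (v - u) + 1 / \<beta> / 2 * (norm (v - u))\<^sup>2"
proof -
  have "(norm (v - q u))\<^sup>2 = (norm (u - q u))\<^sup>2 + 2 * inner (u - q u) (v - u) + (norm (v - u))\<^sup>2"
    by (simp add: power2_norm_eq_inner inner_diff_left inner_diff_right inner_commute)
  then have "(norm (v - q u))\<^sup>2 / (2 * \<beta>) =
      (norm (u - q u))\<^sup>2 / (2 * \<beta>) + inner ((1 / \<beta>) *\<^sub>R (u - q u)) (v - u) + 1 / \<beta> / 2 * (norm (v - u))\<^sup>2"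
    unfolding inner_scaleR_left using assms(2) by (simp add: field_simps)
  then show ?thesis
    using moreau_envelope_le[OF assms(1,2), of v "q u"] by (simp add: moreau_envelope_def q_def)
qed

text \<open>The subgradient inequality of \<open>g\<close> at \<open>q u\<close>, tested at
  \<open>q v\<close>, is combined with the nonnegative square of the difference of the two residuals
  \<open>v - q v\<close> and \<open>u - q u\<close>.\<close>

lemma moreau_envelope_gradient:
  fixes g :: "'a::euclidean_space \<Rightarrow> real"
  assumes "convex_on UNIV g" "\<beta> > 0"
  defines "q \<equiv> \<lambda>u. prox (\<lambda>u. ereal (g u)) u \<beta>"
  shows "moreau_envelope g \<beta> u + inner ((1 / \<beta>) *\<^sub>R (u - q u)) (v - u) \<le> moreau_envelope g \<beta> v"
proof -
  have "0 \<le> (norm ((v - q v) - (u - q u)))\<^sup>2"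
    by simp
  also have "\<dots> = 2 * inner (u - q u) (q v - q u) - 2 * inner (u - q u) (v - u)
      + (norm (v - q v))\<^sup>2 - (norm (u - q u))\<^sup>2"
    by (simp add: power2_norm_eq_inner inner_diff_left inner_diff_right inner_commute)
  finally have "(norm (u - q u))\<^sup>2 + 2 * inner (u - q u) (v - u)
      \<le> 2 * inner (u - q u) (q v - q u) + (norm (v - q v))\<^sup>2"
    by simp
  then have "((norm (u - q u))\<^sup>2 + 2 * inner (u - q u) (v - u)) / (2 * \<beta>)
      \<le> (2 * inner (u - q u) (q v - q u) + (norm (v - q v))\<^sup>2) / (2 * \<beta>)"
    using assms(2) by (intro divide_right_mono) auto
  then have "(norm (u - q u))\<^sup>2 / (2 * \<beta>) + inner ((1 / \<beta>) *\<^sub>R (u - q u)) (v - u)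
      \<le> inner (u - q u) (q v - q u) / \<beta> + (norm (v - q v))\<^sup>2 / (2 * \<beta>)"
    unfolding inner_scaleR_left by (simp add: add_divide_distrib)
  moreover have "g (q u) + inner (u - q u) (q v - q u) / \<beta> \<le> g (q v)"
    using prox_real_subgradient[OF assms(1,2)] by (simp add: q_def)
  ultimately show ?thesis
    by (simp add: moreau_envelope_def q_def)
qed

lemma moreau_envelope_antimono:
  fixes g :: "'a::euclidean_space \<Rightarrow> real"
  assumes "convex_on UNIV g" "0 < \<gamma>" "\<gamma> \<le> \<beta>"
  shows "moreau_envelope g \<beta> u \<le> moreau_envelope g \<gamma> u"
proof -
  define q where "q = prox (\<lambda>u. ereal (g u)) u \<gamma>"
  have "moreau_envelope g \<beta> u \<le> g q + (norm (u - q))\<^sup>2 / (2 * \<beta>)"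
    using assms by (intro moreau_envelope_le) auto
  also have "\<dots> \<le> g q + (norm (u - q))\<^sup>2 / (2 * \<gamma>)"
    using assms by (intro add_left_mono divide_left_mono mult_pos_pos) auto
  finally show ?thesis by (simp add: moreau_envelope_def q_def)
qed

text \<open>Moving from \<open>u\<close> to its proximal point lowers \<open>g\<close> by at most
  \<open>\<rho>\<close> times the distance, and completing the square pays for this with the
  quadratic penalty and \<open>\<beta> * \<rho>\<^sup>2 / 2\<close>.\<close>

lemma le_moreau_envelope:
  fixes g :: "'a::euclidean_space \<Rightarrow> real"
  assumes "\<And>u v. \<bar>g u - g v\<bar> \<le> \<rho> * norm (u - v)" "\<beta> > 0"
  shows "g u \<le> moreau_envelope g \<beta> u + \<beta> * \<rho>\<^sup>2 / 2"
proof -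
  define q where "q = prox (\<lambda>u. ereal (g u)) u \<beta>"
  have "0 \<le> (norm (u - q) - \<beta> * \<rho>)\<^sup>2 / (2 * \<beta>)"
    using assms(2) by simp
  also have "\<dots> = (norm (u - q))\<^sup>2 / (2 * \<beta>) - \<rho> * norm (u - q) + \<beta> * \<rho>\<^sup>2 / 2"
    using assms(2) by (simp add: field_simps power2_eq_square)
  finally show ?thesis
    using assms(1)[of u q] by (simp add: moreau_envelope_def q_def)
qed

text \<open>The competitor for the smaller parameter lies on the segment from \<open>u\<close> to
  the proximal point \<open>q\<close> for \<open>\<beta>\<close>, at the fraction
  \<open>\<gamma> / \<beta>\<close> of the way. The slack left is half of
  \<open>(\<beta> - \<gamma>) * (norm s - \<rho>)\<^sup>2\<close>.\<close>

lemma moreau_envelope_lipschitz_mono: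
  fixes g :: "'a::euclidean_space \<Rightarrow> real"
  assumes "convex_on UNIV g" and lip: "\<And>u v. \<bar>g u - g v\<bar> \<le> \<rho> * norm (u - v)" and \<gamma>: "0 < \<gamma>" "\<gamma> \<le> \<beta>"
  shows "moreau_envelope g \<gamma> u + \<gamma> * \<rho>\<^sup>2 / 2 \<le> moreau_envelope g \<beta> u + \<beta> * \<rho>\<^sup>2 / 2"
proof -
  define q where "q = prox (\<lambda>u. ereal (g u)) u \<beta>"
  define s where "s = (1 / \<beta>) *\<^sub>R (u - q)"
  have u: "u - q = \<beta> *\<^sub>R s"
    using \<gamma> by (simp add: s_def)
  have "(u - \<gamma> *\<^sub>R s) - q = (\<beta> - \<gamma>) *\<^sub>R s"
    using u by (simp add: algebra_simps)
  then have "g (u - \<gamma> *\<^sub>R s) \<le> g q + \<rho> * ((\<beta> - \<gamma>) * norm s)"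
    using lip[of "u - \<gamma> *\<^sub>R s" q] \<gamma> by simp
  moreover have "moreau_envelope g \<gamma> u \<le> g (u - \<gamma> *\<^sub>R s) + \<gamma> * (norm s)\<^sup>2 / 2"
    using moreau_envelope_le[OF assms(1) \<gamma>(1), of u "u - \<gamma> *\<^sub>R s"] \<gamma>
    by (simp add: power_mult_distrib power2_eq_square mult_ac)
  moreover have "moreau_envelope g \<beta> u = g q + \<beta> * (norm s)\<^sup>2 / 2"
    using u \<gamma> by (simp add: moreau_envelope_def q_def[symmetric] power_mult_distrib power2_eq_square)
  moreover have "0 \<le> (\<beta> - \<gamma>) * (norm s - \<rho>)\<^sup>2"
    using \<gamma> by simp
  ultimately show ?thesis
    by (simp add: power2_eq_square algebra_simps)
qed

section \<open>One accelerated proximal gradient step\<close>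

text \<open>Three inequalities are added: the subgradient inequality of the proximal point tested at
  \<open>v\<close>, the linear lower bound at \<open>v\<close>, and the quadratic upper bound at
  \<open>x'\<close>. The terms in \<open>d\<close> cancel.\<close>

lemma prox_gradient_step:
  fixes h :: "'a::euclidean_space \<Rightarrow> ereal" and \<phi> :: "'a \<Rightarrow> real"
  assumes h: "proper_fun h" "lsc h" "econvex h" and L: "L > 0"
    and lower: "\<And>v. \<phi> y + inner d (v - y) \<le> \<phi> v"
    and upper: "\<And>v. \<phi> v \<le> \<phi> y + inner d (v - y) + L / 2 * (norm (v - y))\<^sup>2"
    and x': "x' = prox h (y - (1 / L) *\<^sub>R d) (1 / L)"
    and v: "v \<in> edom h"
  shows "\<phi> x' + real_of_ereal (h x') \<le>
    \<phi> v + real_of_ereal (h v) + L / 2 * (norm (x' - y))\<^sup>2 - L * inner (y - x') (v - x')"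
proof -
  have "real_of_ereal (h x') + L * inner (y - (1 / L) *\<^sub>R d - x') (v - x') \<le> real_of_ereal (h v)"
    using prox_subgradient(2)[OF h _ v, of "1 / L" "y - (1 / L) *\<^sub>R d"] L by (simp add: x' mult.commute)
  moreover have "L * inner (y - (1 / L) *\<^sub>R d - x') (v - x') = L * inner (y - x') (v - x') - inner d (v - x')"
    using L by (simp add: inner_diff_left inner_diff_right algebra_simps)
  moreover have "inner d (v - x') = inner d (v - y) - inner d (x' - y)"
    by (simp add: inner_diff_right)
  ultimately show ?thesis
    using lower[of v] upper[of x'] by linarith
qed

text \<open>The step inequality is averaged over \<open>v = x\<close> and \<open>v = u\<close> with
  weights \<open>1 - \<theta>\<close> and \<open>\<theta>\<close>. Its inner product is affine in
  \<open>v\<close>, so the average \<open>w\<close> takes the place of \<open>v\<close>; completing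
  the square gives distances of \<open>y\<close> and \<open>x'\<close> to \<open>w\<close>, which
  are \<open>\<theta>\<close> times those of \<open>z\<close> and \<open>z'\<close> to
  \<open>u\<close>.\<close>

lemma accelerated_step:
  fixes P :: "'a::real_inner \<Rightarrow> real"
  assumes step: "\<And>v. v \<in> {x, u} \<Longrightarrow>
      P x' \<le> P v + L / 2 * (norm (x' - y))\<^sup>2 - L * inner (y - x') (v - x')"
    and \<theta>: "0 < \<theta>" "\<theta> \<le> 1"
  defines "z \<equiv> x + (1 / \<theta>) *\<^sub>R (y - x)" and "z' \<equiv> x + (1 / \<theta>) *\<^sub>R (x' - x)"
  shows "P x' + L * \<theta>\<^sup>2 * ((norm (z' - u))\<^sup>2 / 2) \<le>
    (1 - \<theta>) * P x + \<theta> * P u + L * \<theta>\<^sup>2 * ((norm (z - u))\<^sup>2 / 2)"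
proof -
  define w where "w = x + \<theta> *\<^sub>R (u - x)"
  define N where "N v = P v + L / 2 * (norm (x' - y))\<^sup>2 - L * inner (y - x') (v - x')" for v
  have "(1 - \<theta>) * P x' + \<theta> * P x' \<le> (1 - \<theta>) * N x + \<theta> * N u"
    using \<theta> step unfolding N_def by (intro add_mono mult_left_mono) auto
  also have "\<dots> = (1 - \<theta>) * P x + \<theta> * P u + L / 2 * (norm (x' - y))\<^sup>2 - L * inner (y - x') (w - x')"
    unfolding N_def w_def
    by (simp add: inner_diff_left inner_diff_right inner_add_right field_simps)
  finally have "(1 - \<theta>) * P x' + \<theta> * P x' \<le> \<dots>" .
  moreover have "(1 - \<theta>) * P x' + \<theta> * P x' = P x'"
    by (simp add: algebra_simps)
  moreover have "L / 2 * (norm (x' - y))\<^sup>2 - L * inner (y - x') (w - x') = L / 2 * (norm (y - w))\<^sup>2 - L / 2 * (norm (x' - w))\<^sup>2"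
    by (simp add: power2_norm_eq_inner inner_diff_left inner_diff_right inner_commute algebra_simps)
  ultimately have "P x' \<le> (1 - \<theta>) * P x + \<theta> * P u + L / 2 * (norm (y - w))\<^sup>2 - L / 2 * (norm (x' - w))\<^sup>2"
    by linarith
  moreover have "y - w = \<theta> *\<^sub>R (z - u)" "x' - w = \<theta> *\<^sub>R (z' - u)"
    using \<theta> by (simp_all add: w_def z_def z'_def algebra_simps)
  then have "(norm (y - w))\<^sup>2 = \<theta>\<^sup>2 * (norm (z - u))\<^sup>2" "(norm (x' - w))\<^sup>2 = \<theta>\<^sup>2 * (norm (z' - u))\<^sup>2"
    by (simp_all add: power_mult_distrib del: scaleR_diff_right)
  ultimately show ?thesis
    by simp
qed

section \<open>Step parameters and the telescoped potential\<close>

text \<open>This is the positive root of \<open>c * \<theta>\<^sup>2 + \<theta> - 1\<close> in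
  rationalized form, which stays valid at \<open>c = 0\<close>.\<close>

lemma prisma_theta_recurrence:
  fixes c :: real
  assumes "c \<ge> 0"
  defines "\<theta> \<equiv> 2 / (1 + sqrt (1 + 4 * c))"
  shows "0 < \<theta>" "\<theta> \<le> 1" "1 - \<theta> = c * \<theta>\<^sup>2"
proof -
  define s where "s = sqrt (1 + 4 * c)"
  have s: "s \<ge> 1" "s\<^sup>2 = 1 + 4 * c" using assms(1) by (simp_all add: s_def)
  have \<theta>: "\<theta> = 2 / (1 + s)" by (simp add: \<theta>_def s_def)
  show "0 < \<theta>" "\<theta> \<le> 1" using s by (simp_all add: \<theta>)
  have c: "c = (s\<^sup>2 - 1) / 4" using s by simp
  show "1 - \<theta> = c * \<theta>\<^sup>2"
    using s(1) by (simp add: \<theta> c divide_simps) (simp add: power2_eq_square algebra_simps)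
qed

lemma prisma_L_eq:
  assumes "prisma L\<^sub>f f g h \<beta> L \<theta> x y" "j \<ge> 1"
  shows "L j = L\<^sub>f + 1 / \<beta> j"
proof -
  obtain i where i: "j = Suc i"
    using assms(2) by (cases j) auto
  show ?thesis
    using assms(1) by (cases "i = 0") (auto simp: prisma_def i)
qed

text \<open>The last identity is the purpose of the recurrence for \<open>\<theta>\<close>: it
  matches the weight of the old gap in one step with the weight of the new gap in the step before,
  so that the steps telescope.\<close>

lemma prisma_theta:
  assumes "prisma L\<^sub>f f g h \<beta> L \<theta> x y" "L\<^sub>f \<ge> 0"
  shows prisma_L_pos: "\<And>j. j \<ge> 1 \<Longrightarrow> L j > 0"
    and prisma_theta_pos: "\<And>j. j \<ge> 1 \<Longrightarrow> 0 < \<theta> j"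
    and prisma_theta_le_1: "\<And>j. j \<ge> 1 \<Longrightarrow> \<theta> j \<le> 1"
    and prisma_theta_eq: "\<And>j. j \<ge> 1 \<Longrightarrow> (1 - \<theta> (Suc j)) / (L (Suc j) * (\<theta> (Suc j))\<^sup>2) = 1 / (L j * (\<theta> j)\<^sup>2)"
proof -
  note p = assms(1)[unfolded prisma_def]
  show L: "L j > 0" if "j \<ge> 1" for j
  proof -
    have "\<beta> j > 0" using p that by blast
    then show ?thesis using assms(2) by (simp add: prisma_L_eq[OF assms(1) that] add_nonneg_pos)
  qed
  define c where "c j = L (Suc j) / ((\<theta> j)\<^sup>2 * L j)" for j
  have c: "c j \<ge> 0" if "j \<ge> 1" for j
    using L[OF that] L[of "Suc j"] by (simp add: c_def)
  have rec: "\<theta> (Suc j) = 2 / (1 + sqrt (1 + 4 * c j))" if "j \<ge> 1" for j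
    using p that by (simp add: c_def)
  have \<theta>: "0 < \<theta> j \<and> \<theta> j \<le> 1" if "j \<ge> 1" for j
    using that
  proof (induction j rule: dec_induct)
    case base
    then show ?case using p by simp
  next
    case (step j)
    then show ?case
      unfolding rec[OF step(1)] using prisma_theta_recurrence[OF c[OF step(1)]] by blast
  qed
  then show "0 < \<theta> j" "\<theta> j \<le> 1" if "j \<ge> 1" for j using that by blast+
  fix j :: nat assume j: "j \<ge> 1"
  have eq: "1 - \<theta> (Suc j) = c j * (\<theta> (Suc j))\<^sup>2"
    unfolding rec[OF j] by (rule prisma_theta_recurrence(3)[OF c[OF j]])
  then show "(1 - \<theta> (Suc j)) / (L (Suc j) * (\<theta> (Suc j))\<^sup>2) = 1 / (L j * (\<theta> j)\<^sup>2)"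
    unfolding eq using L[OF j] L[of "Suc j"] \<theta>[of "Suc j"] \<theta>[OF j] by (simp add: c_def)
qed

text \<open>The potential weighs the smoothed optimality gap, shifted by \<open>\<beta> \<rho>\<^sup>2 / 2\<close> so that it does not
  increase when \<open>\<beta>\<close> shrinks, by \<open>1 / (L \<theta>\<^sup>2)\<close>. The shift costs
  \<open>\<beta> \<rho>\<^sup>2 / 2\<close> times the growth \<open>1 / (L \<theta>)\<close> of the weight in each step.\<close>

lemma prisma_bound:
  fixes f g :: "'a::euclidean_space \<Rightarrow> real"
  assumes f: "convex_on UNIV f" "smooth L\<^sub>f f"
    and g: "convex_on UNIV g" "\<And>u v. \<bar>g u - g v\<bar> \<le> \<rho> * norm (u - v)"
    and h: "proper_fun h" "lsc h" "econvex h"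
    and prisma: "prisma L\<^sub>f f g h \<beta> L \<theta> x y"
    and \<beta>_antimono: "\<And>j. j \<ge> 1 \<Longrightarrow> \<beta> (Suc j) \<le> \<beta> j"
    and k: "k \<ge> 1" and u: "u \<in> edom h"
  defines "F \<equiv> \<lambda>v. f v + g v + real_of_ereal (h v)"
  shows prisma_in_edom: "x (Suc k) \<in> edom h"
    and "F (x (Suc k)) - F u \<le>
      L k * (\<theta> k)\<^sup>2 / 2 * ((norm (u - x 1))\<^sup>2 + \<rho>\<^sup>2 * (\<Sum>j=1..k. \<beta> j / (L j * \<theta> j)))"
proof -
  note p = prisma[unfolded prisma_def]
  note L\<^sub>f = smooth_nonneg[OF f(2)]
  note L_pos = prisma_L_pos[OF prisma L\<^sub>f] and \<theta>_pos = prisma_theta_pos[OF prisma L\<^sub>f]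
    and \<theta>_le_1 = prisma_theta_le_1[OF prisma L\<^sub>f] and \<theta>_eq = prisma_theta_eq[OF prisma L\<^sub>f]
  have \<beta>_pos: "\<beta> j > 0" if "j \<ge> 1" for j using p that by blast
  define q where "q j = prox (\<lambda>u. ereal (g u)) (y j) (\<beta> j)" for j
  \<comment> \<open>This is the slope of \<open>f\<close> plus the envelope at \<open>y j\<close>;
    with it the update becomes a plain proximal gradient step of length
    \<open>1 / L j\<close>.\<close>
  define d where "d j = gradient f (y j) + (1 / \<beta> j) *\<^sub>R (y j - q j)" for j
  have x_Suc: "x (Suc j) = prox h (y j - (1 / L j) *\<^sub>R d j) (1 / L j)" if "j \<ge> 1" for j
  proof -
    have "x (j + 1) = prox h ((1 - 1 / (L j * \<beta> j)) *\<^sub>R y j - (1 / L j) *\<^sub>R gradient f (y j)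
        + (1 / (L j * \<beta> j)) *\<^sub>R q j) (1 / L j)"
      using p that unfolding q_def by blast
    then show ?thesis by (simp add: d_def algebra_simps)
  qed
  have x_dom: "x j \<in> edom h" if "j \<ge> 1" for j
    using that
  proof (induction j rule: dec_induct)
    case base
    then show ?case using p by simp
  next
    case (step j)
    then show ?case
      unfolding x_Suc[OF step(1)] using L_pos by (intro prox_in_edom h) auto
  qed
  then show "x (Suc k) \<in> edom h" by simp
  define \<phi> where "\<phi> j v = f v + moreau_envelope g (\<beta> j) v" for j v
  define P where "P j v = \<phi> j v + real_of_ereal (h v)" for j v
  have step: "P j (x (Suc j)) \<le> P j v + L j / 2 * (norm (x (Suc j) - y j))\<^sup>2
      - L j * inner (y j - x (Suc j)) (v - x (Suc j))" if j: "j \<ge> 1" and v: "v \<in> edom h" for j v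
    unfolding P_def
  proof (rule prox_gradient_step[OF h L_pos[OF j] _ _ x_Suc[OF j] v])
    fix w
    show "\<phi> j (y j) + inner (d j) (w - y j) \<le> \<phi> j w"
      using smooth_convex_gradient[OF f(2,1), of "y j" w] moreau_envelope_gradient[OF g(1) \<beta>_pos[OF j], of "y j" w]
      by (simp add: \<phi>_def d_def q_def inner_add_left)
    show "\<phi> j w \<le> \<phi> j (y j) + inner (d j) (w - y j) + L j / 2 * (norm (w - y j))\<^sup>2"
      using smooth_quadratic_bound[OF f(2), of w "y j"] moreau_envelope_quadratic_bound[OF g(1) \<beta>_pos[OF j], of w "y j"]
      by (simp add: \<phi>_def d_def q_def prisma_L_eq[OF prisma j] inner_add_left add_divide_distrib distrib_right)
  qed
  \<comment> \<open>The momentum coefficient is chosen so that the \<open>z\<close> formed from the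
    new \<open>x\<close> and \<open>y\<close> equals the extrapolation \<open>z'\<close> of
    \<open>accelerated_step\<close>. Distances of \<open>z\<close> to \<open>u\<close> therefore
    chain from step to step.\<close>
  define z where "z j = x j + (1 / \<theta> j) *\<^sub>R (y j - x j)" for j
  have z_Suc: "z (Suc j) = x j + (1 / \<theta> j) *\<^sub>R (x (Suc j) - x j)" if "j \<ge> 1" for j
  proof -
    have "y (Suc j) - x (Suc j) = (\<theta> (Suc j) * (1 / \<theta> j - 1)) *\<^sub>R (x (Suc j) - x j)"
      using p that by simp
    then have "z (Suc j) = x (Suc j) + (1 / \<theta> j - 1) *\<^sub>R (x (Suc j) - x j)"
      using \<theta>_pos[of "Suc j"] by (simp add: z_def)
    then show ?thesis by (simp add: algebra_simps)
  qed
  define W where "W j = 1 / (L j * (\<theta> j)\<^sup>2)" for j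
  define V where "V j = (norm (z j - u))\<^sup>2 / 2" for j
  have W_pos: "W j > 0" if "j \<ge> 1" for j
    using L_pos[OF that] \<theta>_pos[OF that] by (simp add: W_def)
  have descent: "W j * (P j (x (Suc j)) - P j u) + V (Suc j) \<le> W j * (1 - \<theta> j) * (P j (x j) - P j u) + V j"
    if j: "j \<ge> 1" for j
  proof -
    have "P j (x (Suc j)) + L j * (\<theta> j)\<^sup>2 * V (Suc j)
        \<le> (1 - \<theta> j) * P j (x j) + \<theta> j * P j u + L j * (\<theta> j)\<^sup>2 * V j"
      unfolding V_def z_Suc[OF j] unfolding z_def
      using step[OF j] x_dom[OF j] u \<theta>_pos[OF j] \<theta>_le_1[OF j] by (intro accelerated_step) auto
    then have "W j * (P j (x (Suc j)) - P j u + L j * (\<theta> j)\<^sup>2 * V (Suc j))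
        \<le> W j * ((1 - \<theta> j) * (P j (x j) - P j u) + L j * (\<theta> j)\<^sup>2 * V j)"
      using W_pos[OF j] by (intro mult_left_mono) (auto simp: algebra_simps)
    moreover have "W j * (L j * (\<theta> j)\<^sup>2) = 1"
      using L_pos[OF j] \<theta>_pos[OF j] by (simp add: W_def)
    ultimately show ?thesis
      by (simp add: distrib_left mult.assoc[symmetric])
  qed
  define gap where "gap j = P j (x (Suc j)) + \<beta> j * \<rho>\<^sup>2 / 2 - P j u" for j
  have potential: "W k * gap k + V (Suc k) \<le> V 1 + \<rho>\<^sup>2 / 2 * (\<Sum>j=1..k. \<beta> j / (L j * \<theta> j))"
    using k
  proof (induction k rule: dec_induct)
    \<comment> \<open>With \<open>\<theta> 1 = 1\<close> the old gap has coefficient 0, so no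
      initial function value enters the bound.\<close>
    case base
    have "\<theta> 1 = 1" using p by blast
    then show ?case
      using descent[of 1] by (simp add: gap_def W_def algebra_simps)
  next
    case (step j)
    let ?i = "Suc j"
    \<comment> \<open>The second equation is the source of the error sum: the part of the weight not
      inherited from step \<open>j\<close> is \<open>1 / (L \<theta>)\<close>, and the shift by
      \<open>\<beta> * \<rho>\<^sup>2 / 2\<close> has to be paid on it.\<close>
    have W: "W ?i * (1 - \<theta> ?i) = W j" "W ?i = W j + 1 / (L ?i * \<theta> ?i)"
      using \<theta>_eq[OF step(1)] L_pos[of ?i] \<theta>_pos[of ?i] by (simp_all add: W_def field_simps power2_eq_square)
    have "P ?i (x ?i) + \<beta> ?i * \<rho>\<^sup>2 / 2 \<le> P j (x ?i) + \<beta> j * \<rho>\<^sup>2 / 2"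
      using moreau_envelope_lipschitz_mono[OF g \<beta>_pos \<beta>_antimono[OF step(1)]] by (simp add: P_def \<phi>_def)
    moreover have "P j u \<le> P ?i u"
      using moreau_envelope_antimono[OF g(1) \<beta>_pos \<beta>_antimono[OF step(1)]] by (simp add: P_def \<phi>_def)
    ultimately have "W j * (P ?i (x ?i) - P ?i u + \<beta> ?i * \<rho>\<^sup>2 / 2) \<le> W j * gap j"
      using W_pos[OF step(1)] by (intro mult_left_mono) (auto simp: gap_def)
    moreover have "W ?i * gap ?i + V (Suc ?i) \<le> W j * (P ?i (x ?i) - P ?i u) + V ?i + W ?i * (\<beta> ?i * \<rho>\<^sup>2 / 2)"
      using descent[of ?i, unfolded W(1)] by (simp add: gap_def algebra_simps)
    moreover have "W ?i * (\<beta> ?i * \<rho>\<^sup>2 / 2) = W j * (\<beta> ?i * \<rho>\<^sup>2 / 2) + \<rho>\<^sup>2 / 2 * (\<beta> ?i / (L ?i * \<theta> ?i))"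
      by (simp add: W(2) algebra_simps)
    ultimately have "W ?i * gap ?i + V (Suc ?i) \<le> (W j * gap j + V ?i) + \<rho>\<^sup>2 / 2 * (\<beta> ?i / (L ?i * \<theta> ?i))"
      unfolding distrib_left by linarith
    also have "\<dots> \<le> V 1 + \<rho>\<^sup>2 / 2 * (\<Sum>j=1..?i. \<beta> j / (L j * \<theta> j))"
      using step.IH by (simp add: distrib_left)
    finally show ?case .
  qed
  have "F (x (Suc k)) - F u \<le> gap k"
  proof -
    have "g (x (Suc k)) \<le> moreau_envelope g (\<beta> k) (x (Suc k)) + \<beta> k * \<rho>\<^sup>2 / 2"
      by (rule le_moreau_envelope[OF g(2) \<beta>_pos[OF k]])
    moreover have "moreau_envelope g (\<beta> k) u \<le> g u"
      using moreau_envelope_le[OF g(1) \<beta>_pos[OF k], of u u] by simp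
    ultimately show ?thesis by (simp add: F_def gap_def P_def \<phi>_def)
  qed
  also have "gap k = L k * (\<theta> k)\<^sup>2 * (W k * gap k)"
    using L_pos[OF k] \<theta>_pos[OF k] by (simp add: W_def)
  also have "\<dots> \<le> L k * (\<theta> k)\<^sup>2 * (V 1 + \<rho>\<^sup>2 / 2 * (\<Sum>j=1..k. \<beta> j / (L j * \<theta> j)))"
    using L_pos[OF k] potential by (intro mult_left_mono) (auto simp: V_def intro: order_trans[rotated])
  \<comment> \<open>Since \<open>y 1 = x 1\<close>, the auxiliary point \<open>z 1\<close> is
    \<open>x 1\<close> itself.\<close>
  also have "V 1 = (norm (u - x 1))\<^sup>2 / 2"
    using p by (simp add: V_def z_def norm_minus_commute)
  finally show "F (x (Suc k)) - F u \<le>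
      L k * (\<theta> k)\<^sup>2 / 2 * ((norm (u - x 1))\<^sup>2 + \<rho>\<^sup>2 * (\<Sum>j=1..k. \<beta> j / (L j * \<theta> j)))"
    by (simp add: algebra_simps)
qed

section \<open>Explicit rate for the harmonic choice of smoothing parameters\<close>

text \<open>With \<open>t = 1 / \<theta> j\<close> and the ratio \<open>\<kappa>\<close> of
  consecutive \<open>L\<close>, the next value is
  \<open>(1 + sqrt (1 + 4 * \<kappa> * t\<^sup>2)) / 2\<close>. From \<open>\<kappa> \<ge> 1\<close>
  it grows by at least 1/2, and \<open>\<kappa> \<le> 1 + 1 / j\<close> preserves the linear upper
  bound.\<close>

lemma prisma_theta_bounds:
  assumes prisma: "prisma L\<^sub>f f g h \<beta> L \<theta> x y" and L\<^sub>f: "L\<^sub>f \<ge> 0"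
    and L_mono: "\<And>j. j \<ge> 1 \<Longrightarrow> L j \<le> L (Suc j)"
    and L_growth: "\<And>j. j \<ge> 1 \<Longrightarrow> real j * L (Suc j) \<le> real (Suc j) * L j"
    and j: "j \<ge> 1"
  shows "(real j + 1) / 2 \<le> 1 / \<theta> j \<and> 1 / \<theta> j \<le> 3 / 2 * real j"
  using j
proof (induction j rule: dec_induct)
  case base
  have "\<theta> 1 = 1" using prisma by (auto simp: prisma_def)
  then show ?case by simp
next
  case (step j)
  define t where "t = 1 / \<theta> j"
  define \<kappa> where "\<kappa> = L (Suc j) / L j"
  have t: "(real j + 1) / 2 \<le> t" "t \<le> 3 / 2 * real j"
    using step.IH by (simp_all add: t_def)
  have L: "L j > 0"
    by (rule prisma_L_pos[OF prisma L\<^sub>f step(1)])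
  have \<kappa>: "1 \<le> \<kappa>" "real j * \<kappa> \<le> real j + 1"
    using L L_mono[OF step(1)] L_growth[OF step(1)] by (simp_all add: \<kappa>_def field_simps)
  have "\<theta> (j + 1) = 2 / (1 + sqrt (1 + 4 * L (j + 1) / ((\<theta> j)\<^sup>2 * L j)))"
    using prisma step(1) unfolding prisma_def by blast
  also have "4 * L (j + 1) / ((\<theta> j)\<^sup>2 * L j) = 4 * \<kappa> * t\<^sup>2"
    by (simp add: \<kappa>_def t_def power_divide)
  finally have \<theta>: "1 / \<theta> (Suc j) = (1 + sqrt (1 + 4 * \<kappa> * t\<^sup>2)) / 2"
    by simp
  have "(2 * t)\<^sup>2 \<le> 1 + 4 * \<kappa> * t\<^sup>2"
    using mult_right_mono[OF \<kappa>(1), of "t\<^sup>2"] by (simp add: power_mult_distrib)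
  then have "2 * t \<le> sqrt (1 + 4 * \<kappa> * t\<^sup>2)"
    by (rule real_le_rsqrt)
  \<comment> \<open>The bound \<open>3 j + 2\<close> is exactly what yields
    \<open>(3 j + 3) / 2\<close>, the upper bound at the next index.\<close>
  moreover have "sqrt (1 + 4 * \<kappa> * t\<^sup>2) \<le> 3 * real j + 2"
  proof (rule real_le_lsqrt)
    have "4 * \<kappa> * t\<^sup>2 \<le> 4 * \<kappa> * (3 / 2 * real j)\<^sup>2"
      using t \<kappa> by (intro mult_left_mono power_mono) auto
    also have "\<dots> = 9 * real j * (real j * \<kappa>)"
      by (simp add: power2_eq_square)
    also have "\<dots> \<le> 9 * real j * (real j + 1)"
      using \<kappa> by (intro mult_left_mono) auto
    finally show "1 + 4 * \<kappa> * t\<^sup>2 \<le> (3 * real j + 2)\<^sup>2"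
      by (simp add: power2_eq_square algebra_simps)
  qed simp
  ultimately show ?case
    using t by (simp add: \<theta>)
qed

text \<open>This is \<open>ln s \<le> s - 1\<close> at \<open>s = b / c\<close>. It turns relative
  increments of \<open>L\<close> into logarithms, whose sum telescopes.\<close>

lemma diff_div_le_ln:
  fixes b c :: real
  assumes "0 < b" "0 < c"
  shows "(c - b) / c \<le> ln (c / b)"
  using ln_le_minus_one[of "b / c"] assms by (simp add: ln_div diff_divide_distrib)

theorem corollary3p3:
  fixes f g :: "real ^ 'n \<Rightarrow> real" and h F :: "real ^ 'n \<Rightarrow> ereal"
    and L\<^sub>f \<rho>\<^sub>g a :: real and \<beta> L \<theta> :: "nat \<Rightarrow> real"
    and x y :: "nat \<Rightarrow> real ^ 'n" and x_star :: "real ^ 'n" and k :: nat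
  assumes "convex_on UNIV f" and "smooth L\<^sub>f f"
    and "convex_on UNIV g" and "\<And>u v. \<bar>g u - g v\<bar> \<le> \<rho>\<^sub>g * norm (u - v)"
    and "proper_fun h" and "lsc h" and "econvex h"
    and "\<And>u. F u = ereal (f u) + ereal (g u) + h u"
    and "a > 0"
    and "\<And>j. j \<ge> 1 \<Longrightarrow> \<beta> j = 1 / (a * real j)"
    and "prisma L\<^sub>f f g h \<beta> L \<theta> x y"
    and "k \<ge> 1" and "x_star \<in> edom h"
  shows "F (x (k + 1)) - F x_star \<le>
    ereal (2 * ((L\<^sub>f + a * real k) / (real k + 1)\<^sup>2) *
      ((norm (x_star - x 1))\<^sup>2 +
        \<rho>\<^sub>g\<^sup>2 / a * (3 / (2 * a) * ln ((L\<^sub>f + a * real k) / (L\<^sub>f + a)) + 1 / (L\<^sub>f + a))))"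
proof -
  note a = \<open>a > 0\<close> and \<beta> = assms(10) and prisma = assms(11) and k = \<open>k \<ge> 1\<close>
  have L\<^sub>f: "L\<^sub>f \<ge> 0"
    using smooth_nonneg[OF assms(2)] .
  have L: "L j = L\<^sub>f + a * real j" if "j \<ge> 1" for j
    using prisma_L_eq[OF prisma that] \<beta>[OF that] by simp
  note L_pos = prisma_L_pos[OF prisma L\<^sub>f] and \<theta>_pos = prisma_theta_pos[OF prisma L\<^sub>f]
  have \<theta>_bounds: "(real j + 1) / 2 \<le> 1 / \<theta> j \<and> 1 / \<theta> j \<le> 3 / 2 * real j" if "j \<ge> 1" for j
    \<comment> \<open>The growth condition on \<open>L\<close> amounts to
      \<open>j * L\<^sub>f \<le> (j + 1) * L\<^sub>f\<close>, since the terms in \<open>a\<close>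
      agree on both sides.\<close>
    using a L\<^sub>f by (intro prisma_theta_bounds[OF prisma L\<^sub>f _ _ that]) (auto simp: L algebra_simps)
  define S where "S m = (\<Sum>j=1..m. \<beta> j / (L j * \<theta> j))" for m
  have S_bound: "S m \<le> 1 / a * (3 / (2 * a) * ln (L m / L 1) + 1 / L 1)" if "m \<ge> 1" for m
    using that
  proof (induction m rule: dec_induct)
    \<comment> \<open>The first summand is kept exactly and produces \<open>1 / L 1\<close>; only
      the later ones are compared with logarithms.\<close>
    case base
    have "\<theta> 1 = 1" using prisma by (auto simp: prisma_def)
    then show ?case using L_pos[of 1] \<beta>[of 1] by (simp add: S_def)
  next
    case (step m)
    let ?n = "Suc m"
    have "\<beta> ?n / (L ?n * \<theta> ?n) = 1 / (a * real ?n * L ?n) * (1 / \<theta> ?n)"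
      using \<beta>[of ?n] by simp
    \<comment> \<open>The linear bound on \<open>1 / \<theta>\<close> cancels the factor
      \<open>?n\<close> in the denominator of \<open>\<beta>\<close>, leaving a constant times
      \<open>a / L ?n\<close>, the relative increment of \<open>L\<close>.\<close>
    also have "\<dots> \<le> 1 / (a * real ?n * L ?n) * (3 / 2 * real ?n)"
      using \<theta>_bounds[of ?n] L_pos[of ?n] a by (intro mult_left_mono) auto
    also have "\<dots> = 3 / (2 * a\<^sup>2) * (a / L ?n)"
      using a by (simp add: power2_eq_square del: of_nat_Suc)
    also have "a / L ?n = (L ?n - L m) / L ?n"
      using step(1) by (simp add: L algebra_simps)
    also have "3 / (2 * a\<^sup>2) * \<dots> \<le> 3 / (2 * a\<^sup>2) * ln (L ?n / L m)"
      using L_pos[of ?n] L_pos[OF step(1)] by (intro mult_left_mono diff_div_le_ln) auto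
    finally have "S ?n \<le> S m + 3 / (2 * a\<^sup>2) * ln (L ?n / L m)"
      by (simp add: S_def)
    also have "\<dots> \<le> 1 / a * (3 / (2 * a) * ln (L m / L 1) + 1 / L 1) + 3 / (2 * a\<^sup>2) * ln (L ?n / L m)"
      using step.IH by simp
    also have "\<dots> = 1 / a * (3 / (2 * a) * (ln (L m / L 1) + ln (L ?n / L m)) + 1 / L 1)"
      by (simp add: power2_eq_square distrib_left)
    also have "ln (L m / L 1) + ln (L ?n / L m) = ln (L ?n / L 1)"
      using L_pos[of 1] L_pos[of ?n] L_pos[OF step(1)] by (simp add: ln_div)
    finally show ?case .
  qed
  define D where "D = (norm (x_star - x 1))\<^sup>2"
  define E where "E = D + \<rho>\<^sub>g\<^sup>2 / a * (3 / (2 * a) * ln (L k / L 1) + 1 / L 1)"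
  have E: "D + \<rho>\<^sub>g\<^sup>2 * S k \<le> E"
    using mult_left_mono[OF S_bound[OF k], of "\<rho>\<^sub>g\<^sup>2"] by (simp add: E_def)
  have \<beta>_antimono: "\<beta> (Suc j) \<le> \<beta> j" if "j \<ge> 1" for j
    using a that by (simp add: \<beta> divide_simps)
  note bound = prisma_bound[OF assms(1-7) prisma \<beta>_antimono k \<open>x_star \<in> edom h\<close>]
  define G where "G v = f v + g v + real_of_ereal (h v)" for v
  \<comment> \<open>Both points compared lie in the domain of \<open>h\<close>, so the extended-real
    claim reduces to one about the real function \<open>G\<close>.\<close>
  have F: "F v = ereal (G v)" if "v \<in> edom h" for v
    by (subst assms(8), subst proper_fun_finite[OF assms(5) that]) (simp add: G_def)
  have S_nonneg: "0 \<le> S k"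
    unfolding S_def using L_pos \<theta>_pos \<beta> a by (intro sum_nonneg divide_nonneg_pos mult_pos_pos) auto
  \<comment> \<open>The lower bound on \<open>1 / \<theta> k\<close> gives the quadratic decay; the
    upper bound was used only for the error sum.\<close>
  have "(\<theta> k)\<^sup>2 \<le> (2 / (real k + 1))\<^sup>2"
    using \<theta>_bounds[OF k] \<theta>_pos[OF k] by (intro power_mono) (auto simp: field_simps)
  then have \<theta>_sq: "(\<theta> k)\<^sup>2 \<le> 4 / (real k + 1)\<^sup>2"
    by (simp add: power_divide)
  have "G (x (Suc k)) - G x_star \<le> L k * (\<theta> k)\<^sup>2 / 2 * (D + \<rho>\<^sub>g\<^sup>2 * S k)"
    using bound(2) by (simp add: G_def D_def S_def)
  also have "\<dots> \<le> L k * (4 / (real k + 1)\<^sup>2) / 2 * (D + \<rho>\<^sub>g\<^sup>2 * S k)"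
    using \<theta>_sq L_pos[OF k] S_nonneg
    by (intro mult_right_mono divide_right_mono mult_left_mono) (auto simp: D_def)
  also have "\<dots> \<le> L k * (4 / (real k + 1)\<^sup>2) / 2 * E"
    using E L_pos[OF k] by (intro mult_left_mono) auto
  finally have "G (x (Suc k)) - G x_star \<le> 2 * (L k / (real k + 1)\<^sup>2) * E"
    by simp
  then show ?thesis
    using F[OF bound(1)] F[OF \<open>x_star \<in> edom h\<close>] L[OF k] L[of 1] by (simp add: E_def D_def)
qed

end
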